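(* Let $f:\mathbb{R}^{n+m}\to\mathbb{R}$ be a $C^2$ function such that $\nabla f$ is globally Lipschitz with constant $L>0$ and $\nabla^2 f(z^\ast)$ is invertible at every saddle point $z^\ast$ of $f$. Let $\phi>L$ and, for $s>0$, let $w_s(z)=z-s(\nabla F(z)+\phi I)^{-1}F(z)$ (Regularised Damped Newton). Let $W_s$ be either of the following two vector fields: (a) the $O(1)$-resolution field $W_s(z)=-(\nabla F(z)+\phi I)^{-1}F(z)$, in which case it is also required that $\phi>\phi_{\min}$, where $\phi_{\min}$ is a number such that for every $\phi>\phi_{\min}$ all saddle points of $f$ are exponentially stable equilibria of $\dot z=-(\nabla F(z)+\phi I)^{-1}F(z)$ (such a number exists); (b) the $O(s)$-resolution field $$W_s(z)=\Big(-I-\tfrac{s}{2}\big((\nabla F(z)+\phi I)^{-1}\nabla F(z)-(\nabla F(z)+\phi I)^{-1}\nabla^2F(z)(\nabla F(z)+\phi I)^{-1}F(z)\big)\Big)(\nabla F(z)+\phi I)^{-1}F(z),$$ with $s\in(0,s_{\max})$, where $s_{\max}>0$ is a number such that for every $s\in(0,s_{\max})$ all saddle points of $f$ are exponentially stable equilibria of $\dot z=W_s(z)$ (such a number exists). Assume that $w_s(\cdot)$ and $W_s(\cdot)$ are $C^1$ and satisfy the one-step consistency condition: there exists $r\ge2$ such that for every $z_0\in\mathbb{R}^{n+m}$, $|Z(s;z_0)-w_s(z_0)|\le O(s^r)$, where $Z(s;z_0)$ is the solution of $\dot Z=W_s(Z)$ at time $s$ with $Z(0)=z_0$. Then there exists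 $s^\ast>0$ such that for all $s\in(0,s^\ast)$, the set of saddle points of $f$ is a subset of the set of exponentially stable equilibria of $z_{k+1}=z_k-s(\nabla F(z_k)+\phi I)^{-1}F(z_k)$.
   Context: Write $z=(x,y)\in\mathbb{R}^n\times\mathbb{R}^m$. A (local) saddle point of $f$ is a point $(x^\ast,y^\ast)$ having a neighbourhood $U$ such that $f(x^\ast,y)\le f(x^\ast,y^\ast)\le f(x,y^\ast)$ for all $(x,y)\in U$. Notation: $F(z)=\begin{bmatrix}\nabla_x f(z)\\-\nabla_y f(z)\end{bmatrix}$; $\nabla F$ is the Jacobian matrix of $F$; $\nabla^2F(z)$ is the second derivative of $F$, which appears only in the field of case (b) and whose existence is implicit in that field being well defined. For a vector $u$ and a matrix $A$ the expression $A\nabla^2F(z)u$ denotes the matrix $v\mapsto A\,\nabla^2F(z)[v,u]$ (above $A=(\nabla F(z)+\phi I)^{-1}$ and $u=(\nabla F(z)+\phi I)^{-1}F(z)$). For $\phi>L$ the matrix $\nabla F(z)+\phi I$ is invertible for all $z$. "$\le O(s^r)$" means: for the given $z_0$ there are $C\ge0$, $s_0>0$ with the left-hand side at most $Cs^r$ for all $s\in(0,s_0]$. An equilibrium (fixed point) $z^e$ of $z_{k+1}=w_s(z_k)$, i.e. $w_s(z^e)=z^e$, is exponentially stable (meant locally) if it is stable (for every $\varepsilon>0$ there is $\delta>0$ such that $|z_0-z^e|<\delta$ implies $|z_k-z^e|<\varepsilon$ for all $k\ge0$) and there exist $\delta>0$, $M>0$, $\gamma\in(0,1)$ such that $|z_0-z^e|<\delta$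 implies $|z_k-z^e|\le M|z_0-z^e|\gamma^k$ for all $k\ge0$. An equilibrium $z^e$ of $\dot Z=W_s(Z)$, i.e. $W_s(z^e)=0$, is exponentially stable (meant locally) if it is stable (for every $\varepsilon>0$ there is $\delta>0$ such that $|Z(0)-z^e|<\delta$ implies $|Z(t)-z^e|<\varepsilon$ for all $t\ge0$) and there exist $\delta>0$, $M>0$, $\lambda>0$ such that $|Z(0)-z^e|<\delta$ implies $|Z(t)-z^e|\le Me^{-\lambda t}|Z(0)-z^e|$ for all $t\ge0$. *)

theory Defs
  imports "HOL-Analysis.Analysis"
begin

text \<open>Matrices are rendered as linear maps on \<^typ>\<open>'a \<times> 'b\<close>; for the spaces
  \<^typ>\<open>real ^ 'n\<close> and \<^typ>\<open>real ^ 'm\<close> the norm of the product type is the Euclidean norm.\<close>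

section \<open>Differentiability\<close>

definition C1 :: "('a::real_normed_vector \<Rightarrow> 'b::real_normed_vector) \<Rightarrow> bool" where
  "C1 g \<longleftrightarrow> (\<exists>D :: 'a \<Rightarrow> 'a \<Rightarrow>\<^sub>L 'b.
     (\<forall>z. (g has_derivative blinfun_apply (D z)) (at z)) \<and> continuous_on UNIV D)"

definition C2 :: "('a::real_normed_vector \<Rightarrow> 'b::real_normed_vector) \<Rightarrow> bool" where
  "C2 g \<longleftrightarrow> (\<exists>D :: 'a \<Rightarrow> 'a \<Rightarrow>\<^sub>L 'b.
     (\<forall>z. (g has_derivative blinfun_apply (D z)) (at z)) \<and> C1 D)"

definition grad :: "('a::real_inner \<Rightarrow> real) \<Rightarrow> 'a \<Rightarrow> 'a" where
  "grad g z = (THE D. GDERIV g z :> D)"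

definition hessian :: "('a::real_inner \<Rightarrow> real) \<Rightarrow> 'a \<Rightarrow> 'a \<Rightarrow> 'a" where
  "hessian g z = frechet_derivative (grad g) (at z)"

text \<open>The Jacobian is bundled as a bounded linear map so that it takes values in a normed space
  and can itself be differentiated.  \<^const>\<open>Blinfun\<close> is meaningful only for a bounded linear
  argument, i.e. where \<open>G\<close> is differentiable.\<close>

definition jac :: "('a::real_normed_vector \<Rightarrow> 'a) \<Rightarrow> 'a \<Rightarrow> 'a \<Rightarrow>\<^sub>L 'a" where
  "jac G z = Blinfun (frechet_derivative G (at z))"

text \<open>\<open>jac2 G z v u\<close> is \<open>\<nabla>\<^sup>2G(z)[v,u]\<close>: the derivative of the Jacobian in direction \<open>v\<close>,
  applied to \<open>u\<close>.\<close>

definition jac2 :: "('a::real_normed_vector \<Rightarrow> 'a) \<Rightarrow> 'a \<Rightarrow> 'a \<Rightarrow> 'a \<Rightarrow> 'a" where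
  "jac2 G z v u = blinfun_apply (frechet_derivative (jac G) (at z) v) u"

section \<open>Saddle points and the regularised damped Newton method\<close>

definition saddle_point ::
  "(('a::topological_space) \<times> ('b::topological_space) \<Rightarrow> real) \<Rightarrow> 'a \<times> 'b \<Rightarrow> bool" where
  "saddle_point f p \<longleftrightarrow> (\<exists>U. open U \<and> p \<in> U \<and>
     (\<forall>(x, y) \<in> U. f (fst p, y) \<le> f p \<and> f p \<le> f (x, snd p)))"

definition saddle_field ::
  "(('a::real_inner) \<times> ('b::real_inner) \<Rightarrow> real) \<Rightarrow> 'a \<times> 'b \<Rightarrow> 'a \<times> 'b" where
  "saddle_field f z =
     (grad (\<lambda>x. f (x, snd z)) (fst z), - grad (\<lambda>y. f (fst z, y)) (snd z))"

text \<open>\<open>(\<nabla>F(z) + \<phi> I)\<^sup>-\<^sup>1\<close>, where \<open>F = saddle_field f\<close>; a genuine inverse only where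
  \<open>\<nabla>F(z) + \<phi> I\<close> is bijective.\<close>

definition reg_inv ::
  "(('a::real_inner) \<times> ('b::real_inner) \<Rightarrow> real) \<Rightarrow> real \<Rightarrow> 'a \<times> 'b \<Rightarrow> 'a \<times> 'b \<Rightarrow> 'a \<times> 'b" where
  "reg_inv f \<phi> z = inv (\<lambda>v. blinfun_apply (jac (saddle_field f) z) v + \<phi> *\<^sub>R v)"

definition rdn_step ::
  "(('a::real_inner) \<times> ('b::real_inner) \<Rightarrow> real) \<Rightarrow> real \<Rightarrow> real \<Rightarrow> 'a \<times> 'b \<Rightarrow> 'a \<times> 'b" where
  "rdn_step f \<phi> s z = z - s *\<^sub>R reg_inv f \<phi> z (saddle_field f z)"

definition rdn_field_O1 ::
  "(('a::real_inner) \<times> ('b::real_inner) \<Rightarrow> real) \<Rightarrow> real \<Rightarrow> 'a \<times> 'b \<Rightarrow> 'a \<times> 'b" where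
  "rdn_field_O1 f \<phi> z = - reg_inv f \<phi> z (saddle_field f z)"

definition rdn_field_Os ::
  "(('a::real_inner) \<times> ('b::real_inner) \<Rightarrow> real) \<Rightarrow> real \<Rightarrow> real \<Rightarrow> 'a \<times> 'b \<Rightarrow> 'a \<times> 'b" where
  "rdn_field_Os f \<phi> s z =
     (let F = saddle_field f; A = reg_inv f \<phi> z; u = A (F z);
          B = (\<lambda>v. A (blinfun_apply (jac F z) v) - A (jac2 F z v u))
      in (\<lambda>v. - v - (s / 2) *\<^sub>R B v) u)"

section \<open>Exponential stability\<close>

definition exp_stable_map :: "('a::real_normed_vector \<Rightarrow> 'a) \<Rightarrow> 'a \<Rightarrow> bool" where
  "exp_stable_map w ze \<longleftrightarrow> w ze = ze \<and>
     (\<forall>\<epsilon>>0. \<exists>\<delta>>0. \<forall>z0. norm (z0 - ze) < \<delta> \<longrightarrow> (\<forall>k. norm ((w ^^ k) z0 - ze) < \<epsilon>)) \<and>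
     (\<exists>\<delta>>0. \<exists>M>0. \<exists>\<gamma>. 0 < \<gamma> \<and> \<gamma> < 1 \<and>
        (\<forall>z0. norm (z0 - ze) < \<delta> \<longrightarrow>
           (\<forall>k. norm ((w ^^ k) z0 - ze) \<le> M * norm (z0 - ze) * \<gamma> ^ k)))"

definition ode_solution ::
  "('a::real_normed_vector \<Rightarrow> 'a) \<Rightarrow> 'a \<Rightarrow> real set \<Rightarrow> (real \<Rightarrow> 'a) \<Rightarrow> bool" where
  "ode_solution W z0 I Z \<longleftrightarrow>
     Z 0 = z0 \<and> (\<forall>t\<in>I. (Z has_vector_derivative W (Z t)) (at t within I))"

text \<open>The solution bounds ``for all \<open>t \<ge> 0\<close>'' are read as: a solution on \<open>[0, \<infinity>)\<close> exists, and
  every solution obeys the bound as long as it is defined.  Without the existence part the bounds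
  would hold vacuously for initial values that have no global solution.\<close>

definition ode_bounded_by ::
  "('a::real_normed_vector \<Rightarrow> 'a) \<Rightarrow> 'a \<Rightarrow> (real \<Rightarrow> 'a \<Rightarrow> bool) \<Rightarrow> bool" where
  "ode_bounded_by W z0 P \<longleftrightarrow>
     (\<exists>Z. ode_solution W z0 {0..} Z) \<and>
     (\<forall>T>0. \<forall>Z. ode_solution W z0 {0..T} Z \<longrightarrow> (\<forall>t\<in>{0..T}. P t (Z t)))"

definition exp_stable_ode :: "('a::real_normed_vector \<Rightarrow> 'a) \<Rightarrow> 'a \<Rightarrow> bool" where
  "exp_stable_ode W ze \<longleftrightarrow> W ze = 0 \<and>
     (\<forall>\<epsilon>>0. \<exists>\<delta>>0. \<forall>z0. norm (z0 - ze) < \<delta> \<longrightarrow>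
        ode_bounded_by W z0 (\<lambda>t z. norm (z - ze) < \<epsilon>)) \<and>
     (\<exists>\<delta>>0. \<exists>M>0. \<exists>c>0. \<forall>z0. norm (z0 - ze) < \<delta> \<longrightarrow>
        ode_bounded_by W z0 (\<lambda>t z. norm (z - ze) \<le> M * exp (- c * t) * norm (z0 - ze)))"

section \<open>Consistency and the two admissible fields\<close>

text \<open>\<open>S\<close> is the set of step sizes for which the field \<open>W s\<close> is considered.\<close>

definition one_step_consistent ::
  "real set \<Rightarrow> (real \<Rightarrow> 'a::real_normed_vector \<Rightarrow> 'a) \<Rightarrow> (real \<Rightarrow> 'a \<Rightarrow> 'a) \<Rightarrow> bool" where
  "one_step_consistent S w W \<longleftrightarrow>
     (\<exists>r::real\<ge>2. \<forall>z0. \<exists>C\<ge>0. \<exists>s0>0. {0<..s0} \<subseteq> S \<and>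
        (\<forall>s\<in>{0<..s0}. \<exists>Z. ode_solution (W s) z0 {0..s} Z \<and>
           norm (Z s - w s z0) \<le> C * s powr r))"

definition rdn_case_O1 ::
  "(('a::real_inner) \<times> ('b::real_inner) \<Rightarrow> real) \<Rightarrow> real \<Rightarrow> real \<Rightarrow> real set
    \<Rightarrow> (real \<Rightarrow> 'a \<times> 'b \<Rightarrow> 'a \<times> 'b) \<Rightarrow> bool" where
  "rdn_case_O1 f \<phi> \<phi>\<^sub>m\<^sub>i\<^sub>n S W \<longleftrightarrow>
     (\<forall>\<phi>'>\<phi>\<^sub>m\<^sub>i\<^sub>n. \<forall>z. saddle_point f z \<longrightarrow> exp_stable_ode (rdn_field_O1 f \<phi>') z) \<and>
     \<phi> > \<phi>\<^sub>m\<^sub>i\<^sub>n \<and> S = {0<..} \<and> (\<forall>s\<in>S. W s = rdn_field_O1 f \<phi>)"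

definition rdn_case_Os ::
  "(('a::real_inner) \<times> ('b::real_inner) \<Rightarrow> real) \<Rightarrow> real \<Rightarrow> real \<Rightarrow> real set
    \<Rightarrow> (real \<Rightarrow> 'a \<times> 'b \<Rightarrow> 'a \<times> 'b) \<Rightarrow> bool" where
  "rdn_case_Os f \<phi> s\<^sub>m\<^sub>a\<^sub>x S W \<longleftrightarrow>
     (\<forall>z. jac (saddle_field f) differentiable (at z)) \<and>
     s\<^sub>m\<^sub>a\<^sub>x > 0 \<and>
     (\<forall>s\<in>{0<..<s\<^sub>m\<^sub>a\<^sub>x}. \<forall>z. saddle_point f z \<longrightarrow> exp_stable_ode (rdn_field_Os f \<phi> s) z) \<and>
     S = {0<..<s\<^sub>m\<^sub>a\<^sub>x} \<and> (\<forall>s\<in>S. W s = rdn_field_Os f \<phi> s)"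

end

theory Submission
  imports Defs
begin

text \<open>At a saddle point \<open>z\<close> the Jacobian \<open>J = \<nabla>F(z)\<close> is accretive, \<open>\<langle>J v, v\<rangle> \<ge> 0\<close>: the mixed second
  derivatives of \<open>f\<close> cancel by symmetry and the diagonal blocks are positive semidefinite.  With
  \<open>M = (J + \<phi> I)\<^sup>-\<^sup>1 J\<close> and \<open>v = (J + \<phi> I) u\<close> one gets
  \<open>\<langle>v, M v\<rangle> = \<bar>J u\<bar>\<^sup>2 + \<phi> \<langle>u, J u\<rangle> \<ge> \<bar>M v\<bar>\<^sup>2\<close>, hence
  \<open>\<bar>v - s M v\<bar>\<^sup>2 \<le> \<bar>v\<bar>\<^sup>2 - s (2 - s) \<bar>M v\<bar>\<^sup>2\<close>.  As \<open>M\<close> is invertible, the derivative \<open>I - s M\<close> of \<open>w\<^sub>s\<close> at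
  \<open>z\<close> is a strict contraction whenever \<open>0 < s < 2\<close>, whatever the saddle point.\<close>

text \<open>The second difference of \<open>f\<close> over the parallelogram spanned by \<open>t u\<close> and \<open>t v\<close> does not depend on
  the order of \<open>u\<close> and \<open>v\<close>, and the mean value theorem along \<open>u\<close> shows that it is
  \<open>t\<^sup>2 \<langle>H v, u\<rangle> + o(t\<^sup>2)\<close>.\<close>

lemma second_derivative_symmetric:
  fixes f :: "'a::real_inner \<Rightarrow> real"
  assumes G: "\<And>x. GDERIV f x :> G x"
    and H: "(G has_derivative H) (at z)"
  shows "H u \<bullet> v = H v \<bullet> u"
proof -
  have bl: "bounded_linear H"
    using H by (rule has_derivative_bounded_linear)
  have diff: "\<exists>d>0. \<forall>t. 0 < t \<and> t < d \<longrightarrow>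
      \<bar>f (z + t *\<^sub>R u + t *\<^sub>R v) - f (z + t *\<^sub>R u) - f (z + t *\<^sub>R v) + f z - t\<^sup>2 * (H v \<bullet> u)\<bar>
        \<le> 2 * e * t\<^sup>2 * (norm u + norm v)\<^sup>2"
    if "e > 0" for u v e
  proof -
    obtain d where "d > 0"
      and d: "\<And>y. norm (y - z) < d \<Longrightarrow> norm (G y - G z - H (y - z)) \<le> e * norm (y - z)"
      using H \<open>e > 0\<close> unfolding has_derivative_at_alt by blast
    define N where "N = norm u + norm v"
    have "N \<ge> 0" by (simp add: N_def)
    \<comment> \<open>The radius \<open>d / (N + 1)\<close> forces \<open>t * N < d\<close>; the
      added 1 keeps it positive and the division genuine when \<open>u\<close> and \<open>v\<close>
      both vanish.\<close>
    have "\<bar>f (z + t *\<^sub>R u + t *\<^sub>R v) - f (z + t *\<^sub>R u) - f (z + t *\<^sub>R v) + f z - t\<^sup>2 * (H v \<bullet> u)\<bar>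
        \<le> 2 * e * t\<^sup>2 * N\<^sup>2" if t: "0 < t" "t < d / (N + 1)" for t
    proof -
      \<comment> \<open>\<open>g\<close> is the first difference in direction \<open>t v\<close>, so
        \<open>g t - g 0\<close> is the full second difference.\<close>
      define g where "g r = f (z + r *\<^sub>R u + t *\<^sub>R v) - f (z + r *\<^sub>R u)" for r
      have der: "(g has_real_derivative (G (z + r *\<^sub>R u + t *\<^sub>R v) - G (z + r *\<^sub>R u)) \<bullet> u) (at r)" for r
        unfolding g_def has_field_derivative_def
        by (rule has_derivative_eq_rhs, (rule derivative_intros
              has_derivative_compose[OF _ G[unfolded gderiv_def], unfolded o_def])+)
          (auto simp: fun_eq_iff inner_diff_left inner_commute algebra_simps)
      obtain r where r: "0 < r" "r < t"
        and eq: "g t - g 0 = (t - 0) * ((G (z + r *\<^sub>R u + t *\<^sub>R v) - G (z + r *\<^sub>R u)) \<bullet> u)"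
        using MVT2[of 0 t g "\<lambda>r. (G (z + r *\<^sub>R u + t *\<^sub>R v) - G (z + r *\<^sub>R u)) \<bullet> u"] t der by auto
      have tN: "t * N < d"
        using t \<open>N \<ge> 0\<close> by (simp add: field_simps)
      have n1: "norm (r *\<^sub>R u + t *\<^sub>R v) \<le> t * N" and n2: "norm (r *\<^sub>R u) \<le> t * N"
      proof -
        have a: "norm (r *\<^sub>R u) \<le> t * norm u" using r by (simp add: mult_right_mono)
        have b: "norm (t *\<^sub>R v) = t * norm v" using t by simp
        show "norm (r *\<^sub>R u + t *\<^sub>R v) \<le> t * N"
          using norm_triangle_ineq[of "r *\<^sub>R u" "t *\<^sub>R v"] a b unfolding N_def distrib_left by linarith
        have "0 \<le> t * norm v" using t by simp
        then show "norm (r *\<^sub>R u) \<le> t * N"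
          using a unfolding N_def distrib_left by linarith
      qed
      \<comment> \<open>Differentiability of \<open>G\<close> is known only at \<open>z\<close>, so
        both gradients are expanded there. The linear parts differ by exactly \<open>t H v\<close>;
        what remains is the two errors.\<close>
      define e1 where "e1 = G (z + r *\<^sub>R u + t *\<^sub>R v) - G z - H (r *\<^sub>R u + t *\<^sub>R v)"
      define e2 where "e2 = G (z + r *\<^sub>R u) - G z - H (r *\<^sub>R u)"
      have "norm e1 \<le> e * norm (r *\<^sub>R u + t *\<^sub>R v)"
        using d[of "z + r *\<^sub>R u + t *\<^sub>R v"] n1 tN unfolding e1_def by (simp add: add.assoc)
      then have e1: "norm e1 \<le> e * (t * N)"
        using n1 \<open>e > 0\<close> by (meson mult_left_mono order_trans less_imp_le)
      have "norm e2 \<le> e * norm (r *\<^sub>R u)"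
        using d[of "z + r *\<^sub>R u"] n2 tN unfolding e2_def by simp
      then have e2: "norm e2 \<le> e * (t * N)"
        using n2 \<open>e > 0\<close> by (meson mult_left_mono order_trans less_imp_le)
      have G_diff: "G (z + r *\<^sub>R u + t *\<^sub>R v) - G (z + r *\<^sub>R u) = t *\<^sub>R H v + (e1 - e2)"
        unfolding e1_def e2_def
        by (simp add: linear_add[OF bounded_linear.linear[OF bl]]
            linear_scale[OF bounded_linear.linear[OF bl]] algebra_simps)
      have "g t - g 0 - t\<^sup>2 * (H v \<bullet> u) = t * ((e1 - e2) \<bullet> u)"
        using eq unfolding G_diff by (simp add: inner_add_left power2_eq_square algebra_simps)
      also have "\<bar>\<dots>\<bar> = t * \<bar>(e1 - e2) \<bullet> u\<bar>"
        using t by (simp add: abs_mult)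
      also have "\<dots> \<le> t * ((e * (t * N) + e * (t * N)) * N)"
      proof (rule mult_left_mono)
        have "\<bar>(e1 - e2) \<bullet> u\<bar> \<le> norm (e1 - e2) * norm u"
          by (rule Cauchy_Schwarz_ineq2)
        also have "\<dots> \<le> (e * (t * N) + e * (t * N)) * N"
          using norm_triangle_ineq4[of e1 e2] e1 e2 order_trans[OF norm_ge_zero e1]
          by (intro mult_mono) (auto simp: N_def)
        finally show "\<bar>(e1 - e2) \<bullet> u\<bar> \<le> (e * (t * N) + e * (t * N)) * N" .
      qed (use t in simp)
      also have "\<dots> = 2 * e * t\<^sup>2 * N\<^sup>2"
        by (simp add: power2_eq_square algebra_simps)
      finally show ?thesis
        by (simp add: g_def algebra_simps)
    qed
    moreover have "d / (N + 1) > 0"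
      using \<open>d > 0\<close> \<open>N \<ge> 0\<close> by simp
    ultimately show ?thesis
      unfolding N_def by blast
  qed
  have bound: "\<bar>H v \<bullet> u - H u \<bullet> v\<bar> \<le> 4 * e * (norm u + norm v)\<^sup>2" if e: "e > 0" for e
  proof -
    let ?D = "\<lambda>t. f (z + t *\<^sub>R u + t *\<^sub>R v) - f (z + t *\<^sub>R u) - f (z + t *\<^sub>R v) + f z"
    obtain d1 where d1: "d1 > 0" "\<And>t. 0 < t \<Longrightarrow> t < d1 \<Longrightarrow>
        \<bar>?D t - t\<^sup>2 * (H v \<bullet> u)\<bar> \<le> 2 * e * t\<^sup>2 * (norm u + norm v)\<^sup>2"
      using diff[OF e, of u v] by blast
    obtain d2 where d2: "d2 > 0" "\<And>t. 0 < t \<Longrightarrow> t < d2 \<Longrightarrow>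
        \<bar>f (z + t *\<^sub>R v + t *\<^sub>R u) - f (z + t *\<^sub>R v) - f (z + t *\<^sub>R u) + f z - t\<^sup>2 * (H u \<bullet> v)\<bar>
          \<le> 2 * e * t\<^sup>2 * (norm v + norm u)\<^sup>2"
      using diff[OF e, of v u] by blast
    define t where "t = min d1 d2 / 2"
    have t: "0 < t" "t < d1" "t < d2"
      using d1(1) d2(1) by (auto simp: t_def min_def)
    have swap: "f (z + t *\<^sub>R v + t *\<^sub>R u) - f (z + t *\<^sub>R v) - f (z + t *\<^sub>R u) + f z = ?D t"
      by (simp add: algebra_simps)
    have "\<bar>t\<^sup>2 * (H v \<bullet> u) - t\<^sup>2 * (H u \<bullet> v)\<bar> \<le> 4 * e * t\<^sup>2 * (norm u + norm v)\<^sup>2"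
      using d1(2)[OF t(1,2)] d2(2)[OF t(1,3)] unfolding swap add.commute[of "norm v"] by linarith
    moreover have "\<bar>t\<^sup>2 * (H v \<bullet> u) - t\<^sup>2 * (H u \<bullet> v)\<bar> = t\<^sup>2 * \<bar>H v \<bullet> u - H u \<bullet> v\<bar>"
      by (simp add: abs_mult flip: right_diff_distrib)
    ultimately have "t\<^sup>2 * \<bar>H v \<bullet> u - H u \<bullet> v\<bar> \<le> t\<^sup>2 * (4 * e * (norm u + norm v)\<^sup>2)"
      by (simp add: algebra_simps)
    then show ?thesis
      using t(1) by (simp add: mult_le_cancel_left)
  qed
  \<comment> \<open>Tolerance \<open>e / Q\<close> in \<open>bound\<close> yields at most
    \<open>e\<close>, because the factor \<open>Q - 1\<close> is less than \<open>Q\<close>. The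
    added 1 makes \<open>Q\<close> positive even for \<open>u = v = 0\<close>.\<close>
  define Q where "Q = 4 * (norm u + norm v)\<^sup>2 + 1"
  have "Q > 0" using zero_le_power2[of "norm u + norm v"] unfolding Q_def by linarith
  have "\<bar>H v \<bullet> u - H u \<bullet> v\<bar> \<le> 0 + e" if "e > 0" for e
  proof -
    have "4 * (e / Q) * (norm u + norm v)\<^sup>2 = e * ((Q - 1) / Q)"
      by (simp add: Q_def)
    also have "\<dots> \<le> e * 1"
      using \<open>Q > 0\<close> that by (intro mult_left_mono) auto
    finally show ?thesis
      using bound[of "e / Q"] \<open>Q > 0\<close> that by auto
  qed
  then have "\<bar>H v \<bullet> u - H u \<bullet> v\<bar> \<le> 0"
    by (rule field_le_epsilon)
  then show ?thesis by simp
qed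

section \<open>First- and second-order conditions at a local minimum\<close>

lemma local_min_gradient_eq_0:
  assumes "GDERIV f x :> D" and "open U" "x \<in> U" and "\<And>y. y \<in> U \<Longrightarrow> f x \<le> f y"
  shows "D = 0"
proof -
  have "(\<lambda>h. h \<bullet> D) = (\<lambda>h. 0)"
    using assms by (intro differential_zero_maxmin[of x U f]) (auto simp: gderiv_def)
  then have "D \<bullet> D = 0" by meson
  then show ?thesis by simp
qed

text \<open>The slope of \<open>f\<close> along the line through \<open>x\<close> in direction
  \<open>v\<close> vanishes at \<open>x\<close>. Negative curvature would make it negative just
  afterwards, and the mean value theorem would then give points of \<open>U\<close> where
  \<open>f\<close> is below its minimum.\<close>

lemma local_min_second_derivative_nonneg:
  fixes f :: "'a::real_inner \<Rightarrow> real"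
  assumes G: "\<And>x. GDERIV f x :> G x"
    and H: "(G has_derivative H) (at x)"
    and U: "open U" "x \<in> U" and le: "\<And>y. y \<in> U \<Longrightarrow> f x \<le> f y"
  shows "H v \<bullet> v \<ge> 0"
proof (rule ccontr)
  assume neg: "\<not> H v \<bullet> v \<ge> 0"
  have G0: "G x = 0"
    using local_min_gradient_eq_0[OF G U le] .
  have der: "((\<lambda>t. f (x + t *\<^sub>R v)) has_real_derivative G (x + t *\<^sub>R v) \<bullet> v) (at t)" for t
    unfolding has_field_derivative_def
    by (rule has_derivative_eq_rhs, (rule derivative_intros
          has_derivative_compose[OF _ G[unfolded gderiv_def], unfolded o_def])+)
      (auto simp: fun_eq_iff inner_commute)
  have Hv: "H (t *\<^sub>R v) = t *\<^sub>R H v" for t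
    using H by (simp add: has_derivative_bounded_linear linear_scale bounded_linear.linear)
  have "((\<lambda>t. x + t *\<^sub>R v) has_derivative (\<lambda>t. t *\<^sub>R v)) (at 0)"
    by (auto intro!: derivative_eq_intros)
  moreover have "(G has_derivative H) (at (x + 0 *\<^sub>R v))"
    using H by simp
  ultimately have "((\<lambda>t. G (x + t *\<^sub>R v)) has_derivative (\<lambda>t. H (t *\<^sub>R v))) (at 0)"
    by (rule has_derivative_compose)
  then have "((\<lambda>t. G (x + t *\<^sub>R v) \<bullet> v) has_derivative (\<lambda>t. H (t *\<^sub>R v) \<bullet> v)) (at 0)"
    by (rule has_derivative_inner_left)
  then have "((\<lambda>t. G (x + t *\<^sub>R v) \<bullet> v) has_real_derivative H v \<bullet> v) (at 0)"
    unfolding has_field_derivative_def Hv inner_scaleR_left by (simp add: mult_commute_abs)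
  from DERIV_neg_dec_right[OF this] neg obtain d where "d > 0"
    and d: "\<And>h. 0 < h \<Longrightarrow> h < d \<Longrightarrow> G (x + h *\<^sub>R v) \<bullet> v < 0"
    using G0 by auto
  obtain e where "e > 0" and e: "ball x e \<subseteq> U"
    using U openE by blast
  define n where "n = norm v + 1"
  have n: "n > 0" "norm v < n" using norm_ge_zero[of v] unfolding n_def by linarith+
  \<comment> \<open>One bound keeps the slope negative on the open interval from 0 to
    \<open>t\<close>, the other keeps the end point in the ball inside \<open>U\<close>.\<close>
  define t where "t = min d (e / n)"
  have t: "t > 0" "t \<le> d" "t \<le> e / n"
    using \<open>d > 0\<close> \<open>e > 0\<close> n by (auto simp: t_def)
  have "t * norm v < t * n" using n t by simp
  also have "\<dots> \<le> e" using t(3) n by (simp add: field_simps)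
  finally have "t * norm v < e" .
  then have "x + t *\<^sub>R v \<in> U"
    using e t(1) by (auto simp: dist_norm)
  from le[OF this] have "f x \<le> f (x + t *\<^sub>R v)" .
  moreover obtain r where "0 < r" "r < t" "f (x + t *\<^sub>R v) - f x = t * (G (x + r *\<^sub>R v) \<bullet> v)"
    using MVT2[of 0 t "\<lambda>t. f (x + t *\<^sub>R v)" "\<lambda>t. G (x + t *\<^sub>R v) \<bullet> v"] der t(1) by auto
  ultimately show False
    using d[of r] t mult_pos_neg[of t "G (x + r *\<^sub>R v) \<bullet> v"] by auto
qed

section \<open>Bounds on derivatives and a product rule\<close>

text \<open>A short increment along \<open>v\<close> is bounded by the Lipschitz constant and
  approximated by the derivative; dividing by its length parameter leaves an arbitrarily small
  error. Applied to the gradient, this makes \<open>\<phi> > L\<close> large enough to invert the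
  regularised Jacobian.\<close>

lemma lipschitz_derivative_norm_le:
  assumes lip: "L-lipschitz_on UNIV g" and der: "(g has_derivative g') (at z)"
  shows "norm (g' v) \<le> L * norm v"
proof (rule field_le_epsilon)
  fix e :: real assume "e > 0"
  define n where "n = norm v + 1"
  have n: "n > 0" "norm v < n" using norm_ge_zero[of v] unfolding n_def by linarith+
  define e' where "e' = e / n"
  have "e' > 0" using \<open>e > 0\<close> n by (simp add: e'_def)
  obtain d where "d > 0"
    and d: "\<And>y. norm (y - z) < d \<Longrightarrow> norm (g y - g z - g' (y - z)) \<le> e' * norm (y - z)"
    using der \<open>e' > 0\<close> unfolding has_derivative_at_alt by blast
  define t where "t = d / n"
  have t: "t > 0" using \<open>d > 0\<close> n by (simp add: t_def)
  have "t * norm v < t * n" using n t by simp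
  also have "\<dots> = d" using n by (simp add: t_def)
  finally have "norm (t *\<^sub>R v) < d" using t by simp
  then have "norm (g (z + t *\<^sub>R v) - g z - g' (t *\<^sub>R v)) \<le> e' * norm (t *\<^sub>R v)"
    using d[of "z + t *\<^sub>R v"] by simp
  moreover have "norm (g (z + t *\<^sub>R v) - g z) \<le> L * norm (t *\<^sub>R v)"
    using lipschitz_onD[OF lip, of "z + t *\<^sub>R v" z] by (simp add: dist_norm)
  ultimately have "norm (g' (t *\<^sub>R v)) \<le> L * norm (t *\<^sub>R v) + e' * norm (t *\<^sub>R v)"
    using norm_triangle_ineq4[of "g (z + t *\<^sub>R v) - g z" "g (z + t *\<^sub>R v) - g z - g' (t *\<^sub>R v)"] by simp
  then have "t * norm (g' v) \<le> t * (L * norm v + e' * norm v)"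
    using t der by (simp add: has_derivative_bounded_linear linear_scale bounded_linear.linear algebra_simps)
  then have "norm (g' v) \<le> L * norm v + e' * norm v"
    using t by simp
  also have "e' * norm v \<le> e"
    using \<open>e > 0\<close> n by (simp add: e'_def divide_simps)
  finally show "norm (g' v) \<le> L * norm v + e" by simp
qed

text \<open>Mere continuity of \<open>A\<close> suffices because \<open>u\<close> vanishes at
  \<open>z\<close>: in the product \<open>(A y - A z) (u y)\<close> the first factor tends to 0 and
  the second is of order \<open>norm (y - z)\<close>. This matters for a C2 function
  \<open>f\<close>, whose Hessian is continuous but possibly not differentiable.\<close>

lemma has_derivative_blinfun_apply_zero:
  fixes A :: "'a::real_normed_vector \<Rightarrow> 'b::real_normed_vector \<Rightarrow>\<^sub>L 'c::real_normed_vector"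
  assumes A: "isCont A z" and u: "(u has_derivative u') (at z)" and u0: "u z = 0"
  shows "((\<lambda>x. A x (u x)) has_derivative (\<lambda>h. A z (u' h))) (at z)"
  unfolding has_derivative_at_alt
proof (intro conjI allI impI)
  have bl: "bounded_linear u'" using u by (rule has_derivative_bounded_linear)
  then show "bounded_linear (\<lambda>h. A z (u' h))"
    by (rule bounded_linear_compose[OF blinfun.bounded_linear_right])
  fix e :: real assume "e > 0"
  obtain K0 where "K0 > 0" and K0: "\<And>h. norm (u' h) \<le> norm h * K0"
    using bounded_linear.pos_bounded[OF bl] by blast
  define K where "K = K0 + 1"
  have "K > 0" using \<open>K0 > 0\<close> by (simp add: K_def)
  define n where "n = norm (A z) + 1"
  have n: "n > 0" "norm (A z) < n" using norm_ge_zero[of "A z"] unfolding n_def by linarith+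
  \<comment> \<open>Each of the two error terms receives half of \<open>e\<close>. The cap 1 gives
    the growth bound \<open>norm (u y) \<le> K * norm (y - z)\<close> with
    \<open>K = K0 + 1\<close>.\<close>
  define e1 where "e1 = min 1 (e / 2 / n)"
  define e2 where "e2 = e / 2 / K"
  have pos: "e1 > 0" "e2 > 0"
    using \<open>e > 0\<close> \<open>K > 0\<close> n by (auto simp: e1_def e2_def)
  obtain d1 where d1: "d1 > 0" "\<And>y. norm (y - z) < d1 \<Longrightarrow> norm (u y - u' (y - z)) \<le> e1 * norm (y - z)"
    using u pos(1) unfolding has_derivative_at_alt u0 diff_zero by blast
  obtain d2 where d2: "d2 > 0" "\<And>y. norm (y - z) < d2 \<Longrightarrow> norm (A y - A z) < e2"
    using A pos(2) unfolding continuous_at_eps_delta dist_norm by blast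
  have "norm (A y (u y) - A z (u z) - A z (u' (y - z))) \<le> e * norm (y - z)"
    if y: "norm (y - z) < min d1 d2" for y
  proof -
    let ?n = "norm (y - z)"
    have a: "norm (u y - u' (y - z)) \<le> e1 * ?n" using d1(2) y by simp
    also have "\<dots> \<le> 1 * ?n" by (intro mult_right_mono) (auto simp: e1_def)
    finally have "norm (u y) \<le> K * ?n"
      using norm_triangle_sub[of "u y" "u' (y - z)"] K0[of "y - z"] by (simp add: K_def algebra_simps)
    then have "norm (A y - A z) * norm (u y) \<le> e2 * (K * ?n)"
      using d2(2)[of y] y pos(2) by (intro mult_mono) auto
    with norm_blinfun[of "A y - A z" "u y"] have "norm ((A y - A z) (u y)) \<le> e2 * (K * ?n)"
      by (rule order_trans)
    also have "\<dots> = e / 2 * ?n" using \<open>K > 0\<close> by (simp add: e2_def)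
    finally have 1: "norm ((A y - A z) (u y)) \<le> e / 2 * ?n" .
    have "norm (A z) * norm (u y - u' (y - z)) \<le> n * (e1 * ?n)"
      using a n by (intro mult_mono) auto
    with norm_blinfun[of "A z" "u y - u' (y - z)"]
    have "norm (A z (u y - u' (y - z))) \<le> n * (e1 * ?n)"
      by (rule order_trans)
    also have "\<dots> \<le> n * (e / 2 / n * ?n)"
      using n by (intro mult_left_mono mult_right_mono) (auto simp: e1_def)
    also have "\<dots> = e / 2 * ?n" using n by simp
    finally have 2: "norm (A z (u y - u' (y - z))) \<le> e / 2 * ?n" .
    have "A y (u y) - A z (u z) - A z (u' (y - z)) = (A y - A z) (u y) + A z (u y - u' (y - z))"
      by (simp add: u0 blinfun.diff_left blinfun.diff_right blinfun.zero_right)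
    then show ?thesis
      using 1 2 norm_triangle_ineq[of "(A y - A z) (u y)" "A z (u y - u' (y - z))"] by simp
  qed
  then show "\<exists>d>0. \<forall>y. norm (y - z) < d \<longrightarrow>
      norm (A y (u y) - A z (u z) - A z (u' (y - z))) \<le> e * norm (y - z)"
    using d1(1) d2(1) by (intro exI[of _ "min d1 d2"]) auto
qed

section \<open>Contractions and exponential stability\<close>

text \<open>Near \<open>z\<close> the linearisation error fits into the gap between \<open>q\<close>
  and a rate \<open>p < 1\<close>. The map then shrinks distances to \<open>z\<close> by the factor
  \<open>p\<close>, so orbits never leave the small ball and the estimate can be iterated.\<close>

lemma exp_stable_map_if_derivative_contraction:
  fixes w :: "'a::real_normed_vector \<Rightarrow> 'a"
  assumes wz: "w z = z" and w: "(w has_derivative A) (at z)"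
    and q: "q < 1" "\<And>v. norm (A v) \<le> q * norm v"
  shows "exp_stable_map w z"
proof -
  \<comment> \<open>The midpoint is taken from \<open>max q 0\<close> because the decay rate must be
    positive, while \<open>q\<close> may be negative.\<close>
  define p where "p = (max q 0 + 1) / 2"
  have p: "0 < p" "p < 1" "q < p" using q(1) by (auto simp: p_def max_def)
  obtain d where "d > 0"
    and d: "\<And>y. norm (y - z) < d \<Longrightarrow> norm (w y - w z - A (y - z)) \<le> (p - q) * norm (y - z)"
    using w p(3) unfolding has_derivative_at_alt by (metis diff_gt_0_iff_gt)
  have step: "norm (w y - z) \<le> p * norm (y - z)" if "norm (y - z) < d" for y
    using d[OF that] q(2)[of "y - z"] norm_triangle_sub[of "w y - z" "A (y - z)"]
    by (simp add: wz algebra_simps)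
  have iter: "norm ((w ^^ k) y - z) \<le> norm (y - z) * p ^ k" if "norm (y - z) < d" for y k
  proof (induction k)
    case (Suc k)
    have "p ^ k \<le> 1" using p by (simp add: power_le_one)
    then have "norm (y - z) * p ^ k \<le> norm (y - z)"
      using mult_left_mono[of "p ^ k" 1 "norm (y - z)"] by simp
    then have "norm ((w ^^ k) y - z) < d" using Suc that by linarith
    from step[OF this] have "norm ((w ^^ Suc k) y - z) \<le> p * norm ((w ^^ k) y - z)" by simp
    also have "\<dots> \<le> p * (norm (y - z) * p ^ k)" using Suc p by simp
    finally show ?case by (simp add: algebra_simps)
  qed simp
  have bound: "norm ((w ^^ k) y - z) \<le> norm (y - z)" if "norm (y - z) < d" for y k
  proof -
    have "p ^ k \<le> 1" using p by (simp add: power_le_one)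
    then show ?thesis
      using iter[OF that, of k] mult_left_mono[of "p ^ k" 1 "norm (y - z)"] by simp
  qed
  show ?thesis
    unfolding exp_stable_map_def
  proof (intro conjI allI impI)
    show "w z = z" by (fact wz)
    fix e :: real assume "e > 0"
    then show "\<exists>\<delta>>0. \<forall>z0. norm (z0 - z) < \<delta> \<longrightarrow> (\<forall>k. norm ((w ^^ k) z0 - z) < e)"
      using bound \<open>d > 0\<close> by (intro exI[of _ "min d e"]) (auto intro: le_less_trans)
  next
    show "\<exists>\<delta>>0. \<exists>M>0. \<exists>\<gamma>. 0 < \<gamma> \<and> \<gamma> < 1 \<and> (\<forall>z0. norm (z0 - z) < \<delta> \<longrightarrow>
        (\<forall>k. norm ((w ^^ k) z0 - z) \<le> M * norm (z0 - z) * \<gamma> ^ k))"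
      using iter \<open>d > 0\<close> p
      by (intro exI[of _ d] conjI exI[of _ "1::real"] exI[of _ p]) auto
  qed
qed

text \<open>The equation for \<open>M\<close> characterises it without mentioning an inverse. Finite
  dimension turns injectivity of \<open>M\<close> into a uniform lower bound \<open>B\<close>, and
  this makes the contraction factor independent of \<open>v\<close>.\<close>

lemma accretive_resolvent_contraction:
  fixes J M :: "'a::euclidean_space \<Rightarrow> 'a"
  assumes J: "linear J" "inj J" and acc: "\<And>v. J v \<bullet> v \<ge> 0" and "\<phi> > 0"
    and M: "linear M" "\<And>v. J (M v) + \<phi> *\<^sub>R M v = J v" and s: "0 < s" "s < 2"
  shows "\<exists>q<1. \<forall>v. norm (v - s *\<^sub>R M v) \<le> q * norm v"
proof -
  have J0: "J v = 0 \<Longrightarrow> v = 0" for v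
    using J by (simp add: linear_injective_0)
  have "inj M"
    using M J0 J(1) by (metis linear_injective_0 linear_0 scaleR_zero_right add.right_neutral)
  then obtain B where "B > 0" and B: "\<And>v. B * norm v \<le> norm (M v)"
    using linear_inj_bounded_below_pos[OF M(1)] by blast
  have mono: "M v \<bullet> v \<ge> (norm (M v))\<^sup>2" for v
  proof -
    \<comment> \<open>This is the solution of \<open>J u + \<phi> u = v\<close>, read off without
      inverting: subtracting \<open>J u = M v\<close> leaves
      \<open>\<phi> u = v - M v\<close>.\<close>
    define u where "u = (1 / \<phi>) *\<^sub>R (v - M v)"
    have "J u = M v"
    proof -
      have "J (v - M v) = \<phi> *\<^sub>R M v"
        using M(2)[of v] J(1) by (simp add: linear_diff algebra_simps)
      then show ?thesis
        using \<open>\<phi> > 0\<close> J(1) by (simp add: u_def linear_scale)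
    qed
    moreover have "v = M v + \<phi> *\<^sub>R u"
      using \<open>\<phi> > 0\<close> by (simp add: u_def)
    ultimately have "M v \<bullet> v = (norm (M v))\<^sup>2 + \<phi> * (J u \<bullet> u)"
      by (metis inner_add_right inner_scaleR_right power2_norm_eq_inner)
    then show ?thesis
      using acc[of u] \<open>\<phi> > 0\<close> by simp
  qed
  define c where "c = s * (2 - s) * B\<^sup>2"
  have "c > 0" using s \<open>B > 0\<close> by (simp add: c_def)
  \<comment> \<open>The \<open>max 0\<close> keeps the radicand nonnegative without a proof that
    \<open>c \<le> 1\<close>.\<close>
  define q where "q = sqrt (max 0 (1 - c))"
  have "q < 1" using \<open>c > 0\<close> by (simp add: q_def)
  moreover have "norm (v - s *\<^sub>R M v) \<le> q * norm v" for v
  proof (rule power2_le_imp_le)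
    have "(norm (v - s *\<^sub>R M v))\<^sup>2 = (norm v)\<^sup>2 - 2 * s * (M v \<bullet> v) + s\<^sup>2 * (norm (M v))\<^sup>2"
      unfolding power2_norm_eq_inner
      by (simp add: inner_diff_left inner_diff_right inner_commute power2_eq_square algebra_simps)
    also have "\<dots> \<le> (norm v)\<^sup>2 - 2 * s * (norm (M v))\<^sup>2 + s\<^sup>2 * (norm (M v))\<^sup>2"
      using mono[of v] s by simp
    also have "\<dots> = (norm v)\<^sup>2 - s * (2 - s) * (norm (M v))\<^sup>2"
      by (simp add: power2_eq_square algebra_simps)
    also have "\<dots> \<le> (norm v)\<^sup>2 - s * (2 - s) * (B * norm v)\<^sup>2"
      using B[of v] s \<open>B > 0\<close> by (intro diff_left_mono mult_left_mono power_mono) auto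
    also have "\<dots> = (1 - c) * (norm v)\<^sup>2"
      by (simp add: c_def power_mult_distrib algebra_simps)
    also have "\<dots> \<le> max 0 (1 - c) * (norm v)\<^sup>2"
      by (intro mult_right_mono) auto
    also have "\<dots> = (q * norm v)\<^sup>2"
      by (simp add: q_def power_mult_distrib)
    finally show "(norm (v - s *\<^sub>R M v))\<^sup>2 \<le> (q * norm v)\<^sup>2" .
  qed (simp add: q_def)
  ultimately show ?thesis by blast
qed

section \<open>Gradients, the saddle field and saddle points\<close>

lemma grad_eqI:
  assumes "GDERIV g z :> D"
  shows "grad g z = D"
  unfolding grad_def
proof (rule the_equality)
  fix E assume "GDERIV g z :> E"
  then have "(\<lambda>h. h \<bullet> E) = (\<lambda>h. h \<bullet> D)"
    using assms unfolding gderiv_def by (rule has_derivative_unique)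
  then have "\<forall>h. h \<bullet> E = h \<bullet> D" by (simp add: fun_eq_iff)
  then show "E = D" by (rule iffD1[OF vector_eq_ldot])
qed (fact assms)

text \<open>\<open>C2\<close> speaks of a derivative with values in the linear functionals. The
  Riesz map \<open>T\<close>, written in coordinates, turns these into gradient vectors; being
  bounded and linear, it preserves differentiability and continuity of the derivative.\<close>

lemma C2_grad:
  fixes f :: "'a::euclidean_space \<Rightarrow> real"
  assumes "C2 f"
  shows "GDERIV f z :> grad f z" and "C1 (grad f)"
proof -
  obtain D :: "'a \<Rightarrow> 'a \<Rightarrow>\<^sub>L real" and D'
    where D: "\<And>z. (f has_derivative D z) (at z)"
      and D': "\<And>z. (D has_derivative blinfun_apply (D' z)) (at z)" "continuous_on UNIV D'"
    using assms unfolding C2_def C1_def by metis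
  define T :: "('a \<Rightarrow>\<^sub>L real) \<Rightarrow> 'a" where "T = (\<lambda>l. \<Sum>b\<in>Basis. l b *\<^sub>R b)"
  have T: "bounded_linear T"
    unfolding T_def
    by (intro bounded_linear_sum bounded_linear_scaleR_const blinfun.bounded_linear_left)
  have "blinfun_apply l h = h \<bullet> T l" for l h
  proof -
    have "l h = blinfun_apply l (\<Sum>b\<in>Basis. (h \<bullet> b) *\<^sub>R b)" by (simp add: euclidean_representation)
    also have "\<dots> = (\<Sum>b\<in>Basis. (h \<bullet> b) * l b)"
      by (simp add: blinfun.sum_right blinfun.scaleR_right)
    also have "\<dots> = h \<bullet> T l"
      by (simp add: T_def inner_sum_right mult.commute)
    finally show ?thesis .
  qed
  then have G: "GDERIV f z :> T (D z)" for z
    using D unfolding gderiv_def by (metis (no_types, lifting) has_derivative_eq_rhs ext)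
  then have eq: "grad f = (\<lambda>z. T (D z))"
    by (auto intro: grad_eqI)
  show "GDERIV f z :> grad f z" using G by (simp add: eq)
  have app: "blinfun_apply (Blinfun T o\<^sub>L D' z) = (\<lambda>h. T (D' z h))" for z
    by (auto simp: bounded_linear_Blinfun_apply[OF T])
  show "C1 (grad f)"
    unfolding C1_def eq
  proof (intro exI conjI allI)
    show "((\<lambda>z. T (D z)) has_derivative blinfun_apply (Blinfun T o\<^sub>L D' z)) (at z)" for z
      unfolding app using bounded_linear.has_derivative[OF T D'(1)] .
    show "continuous_on UNIV (\<lambda>z. Blinfun T o\<^sub>L D' z)"
      by (intro continuous_intros D')
  qed
qed

lemma saddle_field_eq:
  assumes "\<And>z. GDERIV f z :> G z"
  shows "GDERIV (\<lambda>x. f (x, b)) a :> fst (G (a, b))"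
    and "GDERIV (\<lambda>y. f (a, y)) b :> snd (G (a, b))"
    and "saddle_field f z = (fst (G z), - snd (G z))"
proof -
  have G: "(f has_derivative (\<lambda>h. h \<bullet> G z)) (at z)" for z
    using assms by (simp add: gderiv_def)
  have "((\<lambda>x. f (x, b)) has_derivative (\<lambda>h. (h, 0) \<bullet> G (a, b))) (at a)" for a b
    by (rule has_derivative_compose[where g = f and f = "\<lambda>x. (x, b)", OF _ G]) (auto intro!: derivative_eq_intros)
  then have 1: "GDERIV (\<lambda>x. f (x, b)) a :> fst (G (a, b))" for a b
    by (simp add: gderiv_def inner_prod_def)
  have "((\<lambda>y. f (a, y)) has_derivative (\<lambda>h. (0, h) \<bullet> G (a, b))) (at b)" for a b
    by (rule has_derivative_compose[where g = f and f = "Pair a", OF _ G]) (auto intro!: derivative_eq_intros)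
  then have 2: "GDERIV (\<lambda>y. f (a, y)) b :> snd (G (a, b))" for a b
    by (simp add: gderiv_def inner_prod_def)
  show "GDERIV (\<lambda>x. f (x, b)) a :> fst (G (a, b))"
    and "GDERIV (\<lambda>y. f (a, y)) b :> snd (G (a, b))"
    by (fact 1 2)+
  show "saddle_field f z = (fst (G z), - snd (G z))"
    using grad_eqI[OF 1, of "snd z" "fst z"] grad_eqI[OF 2, of "fst z" "snd z"]
    by (simp add: saddle_field_def)
qed

text \<open>At \<open>z\<close> the slices of \<open>f\<close> in the first variable and of
  \<open>- f\<close> in the second have local minima, so the gradient vanishes and both diagonal
  terms are nonnegative. The sign flip in the second component gives the mixed terms opposite signs,
  and they cancel by symmetry of \<open>H\<close>.\<close>

lemma saddle_point_necessary:
  fixes f :: "'a::real_inner \<times> 'b::real_inner \<Rightarrow> real"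
  assumes G: "\<And>z. GDERIV f z :> G z" and H: "(G has_derivative H) (at z)"
    and z: "saddle_point f z"
  shows "G z = 0" and "H v \<bullet> (fst v, - snd v) \<ge> 0"
proof -
  obtain U where U: "open U" "z \<in> U"
    and saddle: "\<forall>(x, y) \<in> U. f (fst z, y) \<le> f z \<and> f z \<le> f (x, snd z)"
    using z unfolding saddle_point_def by blast
  have le: "f (fst z, y) \<le> f z \<and> f z \<le> f (x, snd z)" if "(x, y) \<in> U" for x y
    using bspec[OF saddle that] by simp
  obtain A B where AB: "open A" "open B" "z \<in> A \<times> B" "A \<times> B \<subseteq> U"
    using open_prod_elim[OF U] .
  have zAB: "fst z \<in> A" "snd z \<in> B"
    using AB(3) by (simp_all add: mem_Times_iff)
  have min1: "f (fst z, snd z) \<le> f (x, snd z)" if "x \<in> A" for x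
  proof -
    have "(x, snd z) \<in> U" using that zAB AB(4) by blast
    from le[OF this] show ?thesis by simp
  qed
  have min2: "- f (fst z, snd z) \<le> - f (fst z, y)" if "y \<in> B" for y
  proof -
    have "(fst z, y) \<in> U" using that zAB AB(4) by blast
    from le[OF this] show ?thesis by simp
  qed
  note g1 = saddle_field_eq(1)[of f G, OF G]
  note g2 = GDERIV_minus[OF saddle_field_eq(2)[of f G, OF G]]
  have "fst (G z) = 0"
    using local_min_gradient_eq_0[OF g1 AB(1) zAB(1) min1] by simp
  moreover have "snd (G z) = 0"
    using local_min_gradient_eq_0[OF g2 AB(2) zAB(2) min2] by simp
  ultimately show "G z = 0" by (simp add: prod_eq_iff)
  have H': "(G has_derivative H) (at (fst z, snd z))" using H by simp
  have "((\<lambda>x. G (x, snd z)) has_derivative (\<lambda>h. H (h, 0))) (at (fst z))"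
    by (rule has_derivative_compose[where g = G and f = "\<lambda>x. (x, snd z)", OF _ H']) (auto intro!: derivative_eq_intros)
  then have h1: "((\<lambda>x. fst (G (x, snd z))) has_derivative (\<lambda>h. fst (H (h, 0)))) (at (fst z))"
    by (rule has_derivative_fst)
  have "((\<lambda>y. G (fst z, y)) has_derivative (\<lambda>h. H (0, h))) (at (snd z))"
    by (rule has_derivative_compose[where g = G and f = "Pair (fst z)", OF _ H']) (auto intro!: derivative_eq_intros)
  then have h2: "((\<lambda>y. - snd (G (fst z, y))) has_derivative (\<lambda>h. - snd (H (0, h)))) (at (snd z))"
    by (intro has_derivative_snd has_derivative_minus)
  obtain a b where v: "v = (a, b)" by (cases v)
  have p1: "fst (H (a, 0)) \<bullet> a \<ge> 0"
    using local_min_second_derivative_nonneg[OF g1 h1 AB(1) zAB(1) min1] .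
  have p2: "- snd (H (0, b)) \<bullet> b \<ge> 0"
    using local_min_second_derivative_nonneg[OF g2 h2 AB(2) zAB(2) min2] .
  have sym: "H (a, 0) \<bullet> (0, b) = H (0, b) \<bullet> (a, 0)"
    by (rule second_derivative_symmetric[OF G H])
  have "linear H" using H by (simp add: has_derivative_bounded_linear bounded_linear.linear)
  then have "H v = H (a, 0) + H (0, b)"
    by (simp add: v flip: linear_add)
  then have "H v \<bullet> (fst v, - snd v) = fst (H (a, 0)) \<bullet> a + - snd (H (0, b)) \<bullet> b"
    using sym by (simp add: v inner_prod_def inner_add_left)
  then show "H v \<bullet> (fst v, - snd v) \<ge> 0" using p1 p2 by simp
qed

section \<open>Stability of saddle points under the damped Newton iteration\<close>

theorem corollary4p17:
  fixes f :: "(real ^ 'n) \<times> (real ^ 'm) \<Rightarrow> real"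
    and L \<phi> \<phi>\<^sub>m\<^sub>i\<^sub>n s\<^sub>m\<^sub>a\<^sub>x :: real
    and S :: "real set"
    and W :: "real \<Rightarrow> (real ^ 'n) \<times> (real ^ 'm) \<Rightarrow> (real ^ 'n) \<times> (real ^ 'm)"
  assumes f_C2: "C2 f"
    and L_pos: "L > 0"
    and grad_lipschitz: "L-lipschitz_on UNIV (grad f)"
    and hessian_invertible: "\<And>z. saddle_point f z \<Longrightarrow> bij (hessian f z)"
    and phi_gt: "\<phi> > L"
    and field: "rdn_case_O1 f \<phi> \<phi>\<^sub>m\<^sub>i\<^sub>n S W \<or> rdn_case_Os f \<phi> s\<^sub>m\<^sub>a\<^sub>x S W"
    and w_C1: "\<And>s. s > 0 \<Longrightarrow> C1 (rdn_step f \<phi> s)"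
    and W_C1: "\<And>s. s \<in> S \<Longrightarrow> C1 (W s)"
    and consistency: "one_step_consistent S (rdn_step f \<phi>) W"
  shows "\<exists>s'>0. \<forall>s\<in>{0<..<s'}.
           {z. saddle_point f z} \<subseteq> {z. exp_stable_map (rdn_step f \<phi> s) z}"
proof -
  define F where "F = saddle_field f"
  \<comment> \<open>The sign flip \<open>P\<close> satisfies \<open>F = P (grad f)\<close>, so the
    Jacobian of \<open>F\<close> is \<open>P\<close> after the Hessian. As \<open>P\<close> is an
    isometry, norm bounds for the Hessian carry over.\<close>
  define P :: "(real ^ 'n) \<times> (real ^ 'm) \<Rightarrow> (real ^ 'n) \<times> (real ^ 'm)"
    where "P = (\<lambda>v. (fst v, - snd v))"
  have P: "bounded_linear P"
    unfolding P_def
    by (intro bounded_linear_Pair bounded_linear_fst bounded_linear_minus bounded_linear_snd)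
  have normP: "norm (P v) = norm v" for v
    by (simp add: P_def norm_prod_def)
  note G = C2_grad(1)[OF f_C2]
  have FP: "F = (\<lambda>z. P (grad f z))"
    unfolding F_def P_def using saddle_field_eq(3)[of f "grad f", OF G] by auto
  obtain H where H: "\<And>z. (grad f has_derivative blinfun_apply (H z)) (at z)"
    and contH: "continuous_on UNIV H"
    using C2_grad(2)[OF f_C2] unfolding C1_def by blast
  have F': "(F has_derivative (\<lambda>v. P (H z v))) (at z)" for z
    unfolding FP by (rule bounded_linear.has_derivative[OF P H])
  have jac_apply: "blinfun_apply (jac F z) = (\<lambda>v. P (H z v))" for z
    unfolding jac_def
    using frechet_derivative_at[OF F'] bounded_linear_Blinfun_apply has_derivative_bounded_linear[OF F']
    by metis
  \<comment> \<open>As a composition of bounded linear maps, the Jacobian inherits continuity in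
    operator norm from \<open>H\<close>.\<close>
  have jac_eq: "jac F = (\<lambda>z. Blinfun P o\<^sub>L H z)"
    by (auto simp: jac_apply bounded_linear_Blinfun_apply[OF P] intro!: blinfun_eqI)
  have contJ: "isCont (jac F) z" for z
  proof -
    have "continuous_on UNIV (jac F)"
      unfolding jac_eq by (intro continuous_intros contH)
    then show ?thesis
      by (metis continuous_on_eq_continuous_at open_UNIV UNIV_I)
  qed
  define R where "R z v = blinfun_apply (jac F z) v + \<phi> *\<^sub>R v" for z v
  have linR: "linear (R z)" for z
    unfolding R_def by (intro linear_compose_add linear_compose_scale_right
        bounded_linear.linear[OF blinfun.bounded_linear_right] linear_ident)
  \<comment> \<open>A kernel vector \<open>v\<close> satisfies
    \<open>\<phi> * norm v = norm (H z v) \<le> L * norm v\<close>, which forces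
    \<open>v = 0\<close> as \<open>\<phi> > L\<close>.\<close>
  have injR: "inj (R z)" for z
    unfolding linear_injective_0[OF linR]
  proof (intro allI impI)
    fix v assume "R z v = 0"
    then have "\<phi> *\<^sub>R v = - jac F z v"
      by (simp add: R_def eq_neg_iff_add_eq_0 add.commute)
    then have "\<bar>\<phi>\<bar> * norm v = norm (H z v)"
      by (metis jac_apply normP norm_minus_cancel norm_scaleR)
    also have "\<dots> \<le> L * norm v"
      by (rule lipschitz_derivative_norm_le[OF grad_lipschitz H])
    finally have "(\<phi> - L) * norm v \<le> 0"
      using phi_gt L_pos by (simp add: algebra_simps)
    then show "v = 0"
      using phi_gt by (simp add: mult_le_0_iff)
  qed
  have surjR: "surj (R z)" for z
    using linear_inj_imp_surj[OF linR injR] .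
  define u where "u z = reg_inv f \<phi> z (F z)" for z
  \<comment> \<open>Surjectivity makes the choice-based \<open>inv\<close> inside
    \<open>reg_inv\<close> a right inverse.\<close>
  have Ru: "R z (u z) = F z" for z
    unfolding u_def reg_inv_def R_def[symmetric] F_def[symmetric]
    by (rule surj_f_inv_f[OF surjR])
  have stable: "exp_stable_map (rdn_step f \<phi> s) z"
    if s: "0 < s" "s < 2" and z: "saddle_point f z" for s z
  proof -
    have Fz: "F z = 0"
      using saddle_point_necessary(1)[OF G H z] by (simp add: FP P_def zero_prod_def)
    then have u0: "u z = 0"
      using Ru[of z] injR[of z] linear_injective_0[OF linR] by metis
    have w: "rdn_step f \<phi> s = (\<lambda>z. z - s *\<^sub>R u z)"
      by (simp add: rdn_step_def u_def F_def fun_eq_iff)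
    obtain w' where w': "(rdn_step f \<phi> s has_derivative w') (at z)"
      using w_C1[OF s(1)] unfolding C1_def by blast
    \<comment> \<open>Differentiability of \<open>u\<close> comes from that of the step map:
      \<open>u\<close> is recovered as the difference of the identity and
      \<open>rdn_step f \<phi> s\<close>, divided by \<open>s\<close>.\<close>
    define M where "M v = (1 / s) *\<^sub>R (v - w' v)" for v
    have "((\<lambda>z. (1 / s) *\<^sub>R (z - rdn_step f \<phi> s z)) has_derivative M) (at z)"
      unfolding M_def by (intro derivative_intros w')
    moreover have "(\<lambda>z. (1 / s) *\<^sub>R (z - rdn_step f \<phi> s z)) = u"
      using s by (simp add: w)
    ultimately have M: "(u has_derivative M) (at z)" by simp
    \<comment> \<open>Differentiating \<open>R x (u x) = F x\<close> at the zero \<open>z\<close> of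
      \<open>u\<close> gives the equation for \<open>M\<close> without differentiating an
      inverse.\<close>
    have "((\<lambda>x. R x (u x)) has_derivative (\<lambda>h. R z (M h))) (at z)"
      unfolding R_def
      by (intro derivative_intros has_derivative_blinfun_apply_zero contJ M u0)
    then have RM: "R z (M v) = jac F z v" for v
      unfolding Ru using has_derivative_unique[OF _ F'] jac_apply by metis
    have linM: "linear M"
      using M by (simp add: has_derivative_bounded_linear bounded_linear.linear)
    have "hessian f z = blinfun_apply (H z)"
      unfolding hessian_def using frechet_derivative_at[OF H] by simp
    then have injH: "inj (blinfun_apply (H z))"
      using hessian_invertible[OF z] by (simp add: bij_is_inj)
    have "inj P" by (auto simp: inj_def P_def prod_eq_iff)
    then have injJ: "inj (blinfun_apply (jac F z))"
      using injH unfolding jac_apply inj_def by blast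
    \<comment> \<open>\<open>P\<close> is self-adjoint, so moving it to the other factor produces
      the pairing from \<open>saddle_point_necessary\<close>.\<close>
    have acc: "jac F z v \<bullet> v \<ge> 0" for v
      using saddle_point_necessary(2)[OF G H z, of v]
      by (simp add: jac_apply P_def inner_prod_def)
    have "\<phi> > 0" using phi_gt L_pos by simp
    obtain q where q: "q < 1" "\<And>v. norm (v - s *\<^sub>R M v) \<le> q * norm v"
      using accretive_resolvent_contraction[OF
          bounded_linear.linear[OF blinfun.bounded_linear_right] injJ acc \<open>\<phi> > 0\<close> linM
          RM[unfolded R_def] s] by blast
    have "v - s *\<^sub>R M v = w' v" for v
      using s by (simp add: M_def)
    with q(2) have w'_le: "norm (w' v) \<le> q * norm v" for v
      by metis
    have "rdn_step f \<phi> s z = z" by (simp add: w u0)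
    from exp_stable_map_if_derivative_contraction[OF this w' q(1) w'_le] show ?thesis .
  qed
  then show ?thesis
    \<comment> \<open>The threshold 2 comes from the sign of \<open>s * (2 - s)\<close> and is the
      same for every saddle point, even though the contraction factor is not.\<close>
    by (intro exI[of _ 2]) auto
qed

end
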